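(* For every integer $n\geq 12$, $\mathrm{ex}_{\mathcal{P}}(n,S_{2,4})\leq \frac{17}{7}n-2$.
   Context: All graphs are finite and simple. For a graph $F$, the planar Turán number $\mathrm{ex}_{\mathcal{P}}(n,F)$ is the maximum number of edges in an $n$-vertex planar graph that contains no subgraph isomorphic to $F$. For positive integers $m,k$, the double star $S_{m,k}$ is the tree obtained from an edge $xy$ (the backbone) by joining $x$ to $m$ new vertices and $y$ to $k$ further new vertices, all these $m+k$ vertices distinct. *)

theory Defs
  imports "HOL-Analysis.Analysis"
begin

definition simple_graph :: "'a set \<Rightarrow> 'a set set \<Rightarrow> bool" where
  "simple_graph V E \<longleftrightarrow> finite V \<and>
     (\<forall>e\<in>E. \<exists>u v. u \<in> V \<and> v \<in> V \<and> u \<noteq> v \<and> e = {u, v})"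

definition planar :: "'a set \<Rightarrow> 'a set set \<Rightarrow> bool" where
  "planar V E \<longleftrightarrow> (\<exists>(p :: 'a \<Rightarrow> complex) (c :: 'a set \<Rightarrow> real \<Rightarrow> complex).
     inj_on p V \<and>
     (\<forall>e\<in>E. arc (c e) \<and> {pathstart (c e), pathfinish (c e)} = p ` e \<and>
              path_image (c e) \<inter> p ` V = p ` e) \<and>
     (\<forall>e\<in>E. \<forall>e'\<in>E. e \<noteq> e' \<longrightarrow>
              path_image (c e) \<inter> path_image (c e') = p ` (e \<inter> e')))"

definition contains_subgraph :: "'b set \<Rightarrow> 'b set set \<Rightarrow> 'a set \<Rightarrow> 'a set set \<Rightarrow> bool" where
  "contains_subgraph VF EF V E \<longleftrightarrow>
     (\<exists>f. inj_on f VF \<and> f ` VF \<subseteq> V \<and> (\<forall>e\<in>EF. f ` e \<in> E))"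

definition double_star_V :: "nat \<Rightarrow> nat \<Rightarrow> nat set" where
  "double_star_V m k = {0..<m+k+2}"

definition double_star_E :: "nat \<Rightarrow> nat \<Rightarrow> nat set set" where
  "double_star_E m k = {{0,1}} \<union> {{0,i} | i. 2 \<le> i \<and> i < m+2}
                        \<union> {{1,i} | i. m+2 \<le> i \<and> i < m+k+2}"

text \<open>Planar Turan number: max edges of an n-vertex planar graph (vertex set
  {0..<n}, w.l.o.g. up to isomorphism) with no subgraph isomorphic to F.\<close>
definition planar_turan :: "nat \<Rightarrow> 'b set \<Rightarrow> 'b set set \<Rightarrow> nat" where
  "planar_turan n VF EF = Max {card E | E. simple_graph {0..<n} E \<and> planar {0..<n} E
        \<and> \<not> contains_subgraph VF EF {0..<n} E}"

end

theory Submission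
  imports Defs
begin

text \<open>
  Of planarity, only the absence of \<open>K\<^bsub>3,3\<^esub>\<close> is needed: a graph without a double star
  \<open>S\<^bsub>2,4\<^esub>\<close> and without \<open>K\<^bsub>3,3\<^esub>\<close> satisfies \<open>7 e \<le> 16 n\<close>, which is at most \<open>17 n - 14\<close>
  for \<open>n \<ge> 14\<close>; for \<open>n = 12, 13\<close> integrality of \<open>e\<close> helps out.

  For this bound, vertices of degree at most 2 can be deleted. If the minimum degree is 3, the
  star condition excludes degrees above 6, and the closed neighbourhood of a vertex of degree 6
  is a component with at most 16 edges. If all degrees are 3, 4 or 5, then
  \<open>3 n\<^sub>5 \<le> 4 n\<^sub>4 + 11 n\<^sub>3\<close> by discharging. A vertex of degree 5 without neighbours of degree 3 has at
  least two neighbours of degree 4. If it has exactly two, then its neighbourhood is a path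
  \<open>z s t z'\<close> plus an apex, and \<open>s\<close>, \<open>t\<close> have a common further neighbour, which has degree 3; so \<open>s\<close>
  and \<open>t\<close> have charge to spare.

  A drawing of \<open>K\<^bsub>3,3\<^esub>\<close> contains a theta curve, formed by the three paths between two vertices of one
  side, and arcs that join the third vertex of that side to all three paths. This contradicts
  the theta curve theorem.
\<close>

subsection \<open>Theta curves and the drawing of \<open>K\<^bsub>3,3\<^esub>\<close>\<close>

text \<open>The inversion \<open>f\<close> exchanges \<open>p\<close> and infinity. If
  \<open>f q\<close> lay outside the image of \<open>S\<close>, mapping that unbounded component
  back would join \<open>q\<close>, off \<open>S\<close>, to points close to \<open>p\<close>, which
  are inside \<open>S\<close>.\<close>

lemma inversion_outside_imp_inside:
  fixes S :: "complex set"
  assumes S: "compact S" and p: "p \<in> inside S" and q: "q \<in> outside S"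
  shows "inverse (q - p) \<in> inside ((\<lambda>z. inverse (z - p)) ` S)"
proof (rule ccontr)
  define f :: "complex \<Rightarrow> complex" where "f = (\<lambda>z. inverse (z - p))"
  define g :: "complex \<Rightarrow> complex" where "g = (\<lambda>w. p + inverse w)"
  have gf: "g (f z) = z" and fg: "f (g z) = z" for z
    by (simp_all add: f_def g_def)
  have pS: "p \<notin> S" and qS: "q \<notin> S" and qp: "q \<noteq> p"
    using p q inside_no_overlap[of S] outside_no_overlap[of S] inside_Int_outside[of S] by blast+
  have "compact (f ` S)"
    unfolding f_def using S pS by (intro compact_continuous_image continuous_intros) auto
  then have b: "bounded (f ` S)" and c: "closed (f ` S)"
    by (auto simp: compact_imp_bounded compact_imp_closed)
  assume "inverse (q - p) \<notin> inside ((\<lambda>z. inverse (z - p)) ` S)"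
  then have "f q \<notin> inside (f ` S)" by (simp add: f_def)
  moreover have "f q \<notin> f ` S" using qS gf by (metis imageE)
  ultimately have fq: "f q \<in> outside (f ` S)" using inside_Un_outside[of "f ` S"] by blast
  \<comment> \<open>\<open>g\<close> is not continuous at 0, which corresponds to infinity. An open
    connected subset of the plane stays connected without a point.\<close>
  define W where "W = outside (f ` S) - {0}"
  have "connected W"
    unfolding W_def using b c
    by (intro connected_open_delete open_outside connected_outside) auto
  then have cg: "connected (g ` W)"
    by (rule connected_continuous_image[rotated]) (auto simp: g_def W_def intro!: continuous_intros)
  have gW: "g ` W \<subseteq> - S"
  proof clarify
    fix w assume "w \<in> W" "g w \<in> S"
    then have "w \<in> f ` S" using fg by (metis imageI)
    with \<open>w \<in> W\<close> show False using outside_no_overlap[of "f ` S"] unfolding W_def by blast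
  qed
  have qW: "q \<in> g ` W"
    using fq gf qp by (intro image_eqI[of _ _ "f q"]) (auto simp: W_def f_def)
  have "open (inside S)" using S by (simp add: open_inside compact_imp_closed)
  with p obtain e where e: "e > 0" "ball p e \<subseteq> inside S"
    by (meson openE)
  have "\<not> bounded (outside (f ` S))" by (rule unbounded_outside[OF b])
  then obtain w where w: "w \<in> outside (f ` S)" "\<not> norm w \<le> max 1 (inverse e)"
    unfolding bounded_iff by blast
  then have "w \<noteq> 0" by auto
  have "inverse (norm w) < e"
    using w(2) e(1) less_imp_inverse_less[of "inverse e" "norm w"] by simp
  then have "g w \<in> ball p e"
    by (simp add: g_def dist_norm norm_inverse)
  then have "g w \<in> inside S" using e by blast
  moreover have "connected_component (- S) (g w) q"
    unfolding connected_component_def using cg gW qW w \<open>w \<noteq> 0\<close> by (auto simp: W_def)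
  ultimately have "q \<in> inside S" by (meson inside_same_component)
  then show False using q inside_Int_outside[of S] by blast
qed

lemma connected_meets_inside:
  assumes "connected K" "K \<inter> S = {}" "x \<in> K" "y \<in> K" "x \<in> inside S"
  shows "y \<in> inside S"
proof -
  have "connected_component (- S) x y"
    unfolding connected_component_def using assms by blast
  then show ?thesis using assms(5) by (rule inside_same_component)
qed

text \<open>The path \<open>c3\<close> cuts the interior of the closed curve of \<open>c1\<close>
  and \<open>c2\<close> into a region bounded by \<open>c1\<close> and \<open>c3\<close> and one
  bounded by \<open>c2\<close> and \<open>c3\<close>. The point \<open>x\<close> lies in one of
  them, and the connected set from \<open>x\<close> to the path not bounding that region would put a
  point of the closed curve into its interior.\<close>

lemma theta_no_common_access_inside:
  fixes c1 c2 c3 :: "real \<Rightarrow> complex"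
  assumes c1: "arc c1" "pathstart c1 = a" "pathfinish c1 = b"
    and c2: "arc c2" "pathstart c2 = a" "pathfinish c2 = b"
    and c3: "arc c3" "pathstart c3 = a" "pathfinish c3 = b"
    and i12: "path_image c1 \<inter> path_image c2 = {a,b}"
    and i13: "path_image c1 \<inter> path_image c3 = {a,b}"
    and i23: "path_image c2 \<inter> path_image c3 = {a,b}"
    and u1: "u1 \<in> path_image c1 - {a,b}" and u2: "u2 \<in> path_image c2 - {a,b}"
    and u3: "u3 \<in> path_image c3 - {a,b}"
    and K1: "connected K1" "x \<in> K1" "u1 \<in> K1" "K1 \<inter> (path_image c2 \<union> path_image c3) = {}"
    and K2: "connected K2" "x \<in> K2" "u2 \<in> K2" "K2 \<inter> (path_image c1 \<union> path_image c3) = {}"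
    and K3: "connected K3" "x \<in> K3" "u3 \<in> K3" "K3 \<inter> (path_image c1 \<union> path_image c2) = {}"
    and ins: "u3 \<in> inside (path_image c1 \<union> path_image c2)"
  shows False
proof -
  let ?I = "\<lambda>c d. inside (path_image c \<union> path_image d)"
  have ab: "a \<noteq> b" using c1 by (auto simp: arc_simple_path)
  have ne: "path_image c3 \<inter> ?I c1 c2 \<noteq> {}" using u3 ins by blast
  obtain "?I c1 c3 \<inter> ?I c2 c3 = {}"
    and split: "?I c1 c3 \<union> ?I c2 c3 \<union> (path_image c3 - {a,b}) = ?I c1 c2"
    using split_inside_simple_closed_curve[OF arc_imp_simple_path[OF c1(1)] c1(2,3)
        arc_imp_simple_path[OF c2(1)] c2(2,3) arc_imp_simple_path[OF c3(1)] c3(2,3) ab i12 i13 i23 ne]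
    by blast
  have "x \<in> ?I c1 c2"
    by (rule connected_meets_inside[OF K3(1) _ K3(3) K3(2) ins]) (use K3 in auto)
  moreover have "x \<notin> path_image c3" using K1 by blast
  ultimately consider "x \<in> ?I c1 c3" | "x \<in> ?I c2 c3" using split by blast
  then show False
  proof cases
    case 1
    have "u2 \<in> ?I c1 c3"
      by (rule connected_meets_inside[OF K2(1) _ K2(2) K2(3) 1]) (use K2 in auto)
    then have "u2 \<in> ?I c1 c2" using split by blast
    then show False using u2 inside_no_overlap by blast
  next
    case 2
    have "u1 \<in> ?I c2 c3"
      by (rule connected_meets_inside[OF K1(1) _ K1(2) K1(3) 2]) (use K1 in auto)
    then have "u1 \<in> ?I c1 c2" using split by blast
    then show False using u1 inside_no_overlap by blast
  qed
qed

text \<open>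
  If \<open>u3\<close> lies outside the closed curve formed by \<open>c1\<close> and \<open>c2\<close>, an inversion at a point inside that
  curve moves it inside.
\<close>

lemma theta_no_common_access:
  fixes c1 c2 c3 :: "real \<Rightarrow> complex"
  assumes c1: "arc c1" "pathstart c1 = a" "pathfinish c1 = b"
    and c2: "arc c2" "pathstart c2 = a" "pathfinish c2 = b"
    and c3: "arc c3" "pathstart c3 = a" "pathfinish c3 = b"
    and i12: "path_image c1 \<inter> path_image c2 = {a,b}"
    and i13: "path_image c1 \<inter> path_image c3 = {a,b}"
    and i23: "path_image c2 \<inter> path_image c3 = {a,b}"
    and u1: "u1 \<in> path_image c1 - {a,b}" and u2: "u2 \<in> path_image c2 - {a,b}"
    and u3: "u3 \<in> path_image c3 - {a,b}"
    and K1: "connected K1" "connected (insert u1 K1)" "x \<in> K1"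
      "K1 \<inter> (path_image c1 \<union> path_image c2 \<union> path_image c3) = {}"
    and K2: "connected K2" "connected (insert u2 K2)" "x \<in> K2"
      "K2 \<inter> (path_image c1 \<union> path_image c2 \<union> path_image c3) = {}"
    and K3: "connected K3" "connected (insert u3 K3)" "x \<in> K3"
      "K3 \<inter> (path_image c1 \<union> path_image c2 \<union> path_image c3) = {}"
  shows False
proof -
  let ?C = "path_image c1 \<union> path_image c2"
  have "simple_path (c1 +++ reversepath c2)" "pathfinish (c1 +++ reversepath c2) = pathstart (c1 +++ reversepath c2)"
    using c1 c2 i12 by (auto simp: simple_path_join_loop_eq arc_simple_path simple_path_reversepath)
  then have "inside (path_image (c1 +++ reversepath c2)) \<noteq> {}"
    using Jordan_inside_outside by blast
  then obtain p where p: "p \<in> inside ?C"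
    using c1 c2 by (auto simp: path_image_join)
  have cpt: "compact ?C" using c1 c2 by (simp add: compact_Un compact_arc_image)
  have u3C: "u3 \<notin> ?C" using u3 i13 i23 by blast
  have arcs: "insert u1 K1 \<inter> (path_image c2 \<union> path_image c3) = {}"
    "insert u2 K2 \<inter> (path_image c1 \<union> path_image c3) = {}"
    "insert u3 K3 \<inter> ?C = {}"
    using K1(4) K2(4) K3(4) u1 u2 u3 i12 i13 i23 by auto
  have u3out: "u3 \<in> outside ?C"
    using theta_no_common_access_inside[OF c1 c2 c3 i12 i13 i23 u1 u2 u3
        K1(2) _ _ arcs(1) K2(2) _ _ arcs(2) K3(2) _ _ arcs(3)] K1(3) K2(3) K3(3)
      u3C inside_Un_outside[of ?C] by blast
  have pC: "p \<notin> ?C" using p inside_no_overlap by blast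
  \<comment> \<open>The inversion is continuous only off its centre. If \<open>p\<close> lay on
    \<open>c3\<close> or in some \<open>K\<close> set, it could be joined to \<open>u3\<close>
    without meeting the closed curve; for this the \<open>K\<close> sets come without
    \<open>u1\<close>, \<open>u2\<close>, \<open>u3\<close>.\<close>
  have pnot: "p \<notin> path_image c3 \<union> (K1 \<union> K2 \<union> K3)"
  proof
    assume "p \<in> path_image c3 \<union> (K1 \<union> K2 \<union> K3)"
    then consider "p \<in> path_image c3 - {a,b}" | "p \<in> K1 \<union> K2 \<union> K3" using pC i13 by blast
    then have "u3 \<in> inside ?C"
    proof cases
      case 1
      have "connected (path_image c3 - {a,b})"
        using connected_simple_path_endless[OF arc_imp_simple_path[OF c3(1)]] c3 by simp
      then show ?thesis
        by (rule connected_meets_inside[OF _ _ 1 u3 p]) (use i13 i23 in blast)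
    next
      case 2
      have "connected (K1 \<union> K2 \<union> K3)"
        using K1(1,3) K2(1,3) K3(1,3) by (intro connected_Un) blast+
      then have "x \<in> inside ?C"
        by (rule connected_meets_inside[OF _ _ 2 _ p]) (use K1(3,4) K2(4) K3(4) in blast)+
      then show ?thesis
        by (rule connected_meets_inside[OF K3(2) arcs(3), rotated 2]) (use K3(3) in auto)
    qed
    then show False using u3out inside_Int_outside by blast
  qed
  have pu: "p \<noteq> u1" "p \<noteq> u2" "p \<noteq> u3" using pC pnot u1 u2 u3 by auto
  define f :: "complex \<Rightarrow> complex" where "f = (\<lambda>z. inverse (z - p))"
  have inj: "inj f" by (auto simp: f_def inj_on_def)
  have cont: "continuous_on T f" if "p \<notin> T" for T
    unfolding f_def using that by (intro continuous_intros) auto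
  have arc_f: "arc (f \<circ> c)" if "arc c" "p \<notin> path_image c" for c
  proof -
    have "simple_path (f \<circ> c)"
      by (rule simple_path_continuous_image[OF arc_imp_simple_path[OF that(1)] cont[OF that(2)] inj_on_subset[OF inj subset_UNIV]])
    then show ?thesis
      using that inj by (simp add: arc_simple_path pathstart_compose pathfinish_compose inj_eq)
  qed
  have conn_f: "connected (f ` K)" if "connected K" "p \<notin> K" for K
    using that cont by (intro connected_continuous_image)
  have pi: "path_image (f \<circ> c) = f ` path_image c" for c by (rule path_image_compose)
  have img: "f ` A \<inter> f ` B = f ` (A \<inter> B)" for A B using inj by (simp add: image_Int)
  have emp: "f ` A \<inter> (f ` B \<union> f ` C) = {}" if "A \<inter> (B \<union> C) = {}" for A B C
    using that by (metis img image_Un image_empty)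
  have mem: "f u \<in> f ` A - {f a, f b}" if "u \<in> A - {a, b}" for u A
    using that inj by (auto simp: inj_eq)
  have pc: "p \<notin> path_image c1" "p \<notin> path_image c2" "p \<notin> path_image c3"
    and pK: "p \<notin> insert u1 K1" "p \<notin> insert u2 K2" "p \<notin> insert u3 K3"
    using pC pnot pu by auto
  show False
  proof (rule theta_no_common_access_inside[of "f \<circ> c1" "f a" "f b" "f \<circ> c2" "f \<circ> c3" "f u1" "f u2" "f u3"
         "f ` insert u1 K1" "f x" "f ` insert u2 K2" "f ` insert u3 K3"], unfold pi pathstart_compose pathfinish_compose c1(2,3) c2(2,3) c3(2,3))
    show "f u3 \<in> inside (f ` path_image c1 \<union> f ` path_image c2)"
      using inversion_outside_imp_inside[OF cpt p u3out] by (simp add: f_def image_Un)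
    show "arc (f \<circ> c1)" "arc (f \<circ> c2)" "arc (f \<circ> c3)"
      using arc_f c1(1) c2(1) c3(1) pc by blast+
    show "connected (f ` insert u1 K1)" "connected (f ` insert u2 K2)" "connected (f ` insert u3 K3)"
      using conn_f K1(2) K2(2) K3(2) pK by blast+
    show "f u1 \<in> f ` path_image c1 - {f a, f b}" "f u2 \<in> f ` path_image c2 - {f a, f b}"
      "f u3 \<in> f ` path_image c3 - {f a, f b}"
      using mem u1 u2 u3 by blast+
    show "f ` path_image c1 \<inter> f ` path_image c2 = {f a, f b}"
      "f ` path_image c1 \<inter> f ` path_image c3 = {f a, f b}"
      "f ` path_image c2 \<inter> f ` path_image c3 = {f a, f b}"
      unfolding img i12 i13 i23 by simp_all
    show "f ` insert u1 K1 \<inter> (f ` path_image c2 \<union> f ` path_image c3) = {}"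
      "f ` insert u2 K2 \<inter> (f ` path_image c1 \<union> f ` path_image c3) = {}"
      "f ` insert u3 K3 \<inter> (f ` path_image c1 \<union> f ` path_image c2) = {}"
      by (rule emp[OF arcs(1)], rule emp[OF arcs(2)], rule emp[OF arcs(3)])
    show "f x \<in> f ` insert u1 K1" "f x \<in> f ` insert u2 K2" "f x \<in> f ` insert u3 K3"
      using K1(3) K2(3) K3(3) by blast+
    show "f u1 \<in> f ` insert u1 K1" "f u2 \<in> f ` insert u2 K2" "f u3 \<in> f ` insert u3 K3"
      by blast+
  qed (rule refl)+
qed

lemma connected_arc_minus_pathfinish:
  fixes c :: "real \<Rightarrow> 'a::topological_space"
  assumes "arc c"
  shows "connected (path_image c - {pathfinish c})"
proof -
  have "path_image c - {pathfinish c} = c ` {0..<1}"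
  proof (intro equalityI subsetI)
    fix z assume "z \<in> path_image c - {pathfinish c}"
    then obtain t where "t \<in> {0..1}" "z = c t" "z \<noteq> c 1"
      by (auto simp: path_image_def pathfinish_def)
    then show "z \<in> c ` {0..<1}" by (cases "t = 1") auto
  next
    fix z assume "z \<in> c ` {0..<1}"
    then obtain t where t: "t \<in> {0..<1}" "z = c t" by blast
    then have "c t \<noteq> c 1" using assms unfolding arc_def inj_on_def by force
    with t show "z \<in> path_image c - {pathfinish c}" by (auto simp: path_image_def pathfinish_def)
  qed
  moreover have "continuous_on {0..<1} c"
    using assms unfolding arc_def path_def by (auto intro: continuous_on_subset)
  ultimately show ?thesis by (metis connected_continuous_image is_interval_co is_interval_connected)
qed

text \<open>A drawing fixes only the set of end points of an arc, so the arc may have to be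
  reversed.\<close>

lemma arc_orient:
  assumes "arc c" "{pathstart c, pathfinish c} = {a, b}"
  obtains d where "arc d" "pathstart d = a" "pathfinish d = b" "path_image d = path_image c"
proof (cases "pathstart c = a \<and> pathfinish c = b")
  case True
  then show ?thesis using assms that by blast
next
  case False
  then have "pathstart c = b" "pathfinish c = a" using assms(2) by (auto simp: doubleton_eq_iff)
  then show ?thesis using assms(1) that[of "reversepath c"] by (simp add: arc_reversepath)
qed

lemma planar_no_K33:
  assumes pl: "planar V E" and V: "X \<union> U \<subseteq> V" and XU: "X \<inter> U = {}"
    and X: "card X = 3" and U: "card U = 3"
    and E: "\<And>x u. x \<in> X \<Longrightarrow> u \<in> U \<Longrightarrow> {x, u} \<in> E"
  shows False
proof -
  obtain p and c :: "_ \<Rightarrow> real \<Rightarrow> complex" where inj: "inj_on p V"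
    and edge: "\<forall>e\<in>E. arc (c e) \<and> {pathstart (c e), pathfinish (c e)} = p ` e \<and>
              path_image (c e) \<inter> p ` V = p ` e"
    and crossing: "\<forall>e\<in>E. \<forall>e'\<in>E. e \<noteq> e' \<longrightarrow>
              path_image (c e) \<inter> path_image (c e') = p ` (e \<inter> e')"
    using pl unfolding planar_def by blast
  have ce: "arc (c e)" and ends: "{pathstart (c e), pathfinish (c e)} = p ` e" if "e \<in> E" for e
    using edge that by simp_all
  have cross: "path_image (c e) \<inter> path_image (c e') = p ` (e \<inter> e')" if "e \<in> E" "e' \<in> E" "e \<noteq> e'" for e e'
    using crossing that by simp
  obtain x1 x2 x3 where x: "X = {x1, x2, x3}" "x1 \<noteq> x2" "x1 \<noteq> x3" "x2 \<noteq> x3"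
    using X by (auto simp: card_3_iff)
  obtain u1 u2 u3 where u: "U = {u1, u2, u3}" "u1 \<noteq> u2" "u1 \<noteq> u3" "u2 \<noteq> u3"
    using U by (auto simp: card_3_iff)
  have xu: "x \<noteq> u" if "x \<in> X" "u \<in> U" for x u using XU that by blast
  have pinj: "p y = p z \<longleftrightarrow> y = z" if "y \<in> X \<union> U" "z \<in> X \<union> U" for y z
    using inj that V by (auto simp: inj_on_eq_iff subset_iff)
  have ex: "\<exists>d. arc d \<and> pathstart d = p x \<and> pathfinish d = p u \<and> path_image d = path_image (c {x, u})"
    if "x \<in> X" "u \<in> U" for x u
  proof -
    have "{pathstart (c {x, u}), pathfinish (c {x, u})} = {p x, p u}"
      using ends[OF E[OF that]] by simp
    from arc_orient[OF ce[OF E[OF that]] this] show ?thesis by metis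
  qed
  define Q where "Q x u = (SOME d. arc d \<and> pathstart d = p x \<and> pathfinish d = p u \<and>
      path_image d = path_image (c {x, u}))" for x u
  have Q: "arc (Q x u)" "pathstart (Q x u) = p x" "pathfinish (Q x u) = p u"
      "path_image (Q x u) = path_image (c {x, u})" if "x \<in> X" "u \<in> U" for x u
    using someI_ex[OF ex[OF that]] unfolding Q_def by blast+
  have QQ: "path_image (Q x u) \<inter> path_image (Q x' u') = p ` ({x, u} \<inter> {x', u'})"
    if "x \<in> X" "u \<in> U" "x' \<in> X" "u' \<in> U" "x \<noteq> x' \<or> u \<noteq> u'" for x u x' u'
  proof -
    have "{x, u} \<noteq> {x', u'}" using that XU by (auto simp: doubleton_eq_iff)
    then show ?thesis using that by (simp add: Q cross E)
  qed
  have same_x: "path_image (Q x u) \<inter> path_image (Q x u') = {p x}"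
    if "x \<in> X" "u \<in> U" "u' \<in> U" "u \<noteq> u'" for x u u'
  proof -
    have "{x, u} \<inter> {x, u'} = {x}" using that XU by auto
    then show ?thesis using QQ[of x u x u'] that by simp
  qed
  have same_u: "path_image (Q x u) \<inter> path_image (Q x' u) = {p u}"
    if "x \<in> X" "x' \<in> X" "u \<in> U" "x \<noteq> x'" for x x' u
  proof -
    have "{x, u} \<inter> {x', u} = {u}" using that XU by auto
    then show ?thesis using QQ[of x u x' u] that by simp
  qed
  have diff: "path_image (Q x u) \<inter> path_image (Q x' u') = {}"
    if "x \<in> X" "x' \<in> X" "u \<in> U" "u' \<in> U" "x \<noteq> x'" "u \<noteq> u'" for x x' u u'
  proof -
    have "{x, u} \<inter> {x', u'} = {}" using that XU by auto
    then show ?thesis using QQ[of x u x' u'] that by simp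
  qed
  have mem: "x1 \<in> X" "x2 \<in> X" "x3 \<in> X" "u1 \<in> U" "u2 \<in> U" "u3 \<in> U" using x u by auto
  \<comment> \<open>\<open>C u\<close> runs from \<open>x1\<close> through \<open>u\<close> to
    \<open>x2\<close>; the three of them form a theta curve. \<open>K u\<close> is the arc from
    \<open>x3\<close> to \<open>u\<close> without its end on that curve.\<close>
  define C where "C u = Q x1 u +++ reversepath (Q x2 u)" for u
  define K where "K u = path_image (Q x3 u) - {p u}" for u
  have piC: "path_image (C u) = path_image (Q x1 u) \<union> path_image (Q x2 u)" if "u \<in> U" for u
    using that mem by (simp add: C_def Q path_image_join)
  have C: "arc (C u)" "pathstart (C u) = p x1" "pathfinish (C u) = p x2" if "u \<in> U" for u
    using that mem x same_u[of x1 x2 u] by (auto simp: C_def Q intro!: arc_join arc_reversepath)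
  have CC: "path_image (C u) \<inter> path_image (C u') = {p x1, p x2}" if "u \<in> U" "u' \<in> U" "u \<noteq> u'" for u u'
    using same_x[of x1 u u'] same_x[of x2 u u'] diff[of x1 x2 u u'] diff[of x2 x1 u u'] mem x that
    unfolding piC[OF that(1)] piC[OF that(2)] by blast
  have pu: "p u \<in> path_image (Q x u)" "p x \<in> path_image (Q x u)" if "u \<in> U" "x \<in> X" for x u
    using Q(2,3)[OF that(2,1)] pathfinish_in_path_image pathstart_in_path_image by metis+
  have uC: "p u \<in> path_image (C u) - {p x1, p x2}" if "u \<in> U" for u
  proof -
    have "p u \<noteq> p x1" "p u \<noteq> p x2" using that mem xu pinj by (metis UnCI)+
    then show ?thesis using that mem pu by (simp add: piC)
  qed
  have K: "connected (K u)" "connected (insert (p u) (K u))" "p x3 \<in> K u" if "u \<in> U" for u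
  proof -
    show "connected (K u)"
      using connected_arc_minus_pathfinish[OF Q(1)[of x3 u]] that mem by (simp add: K_def Q)
    have "insert (p u) (K u) = path_image (Q x3 u)"
      using that mem pu by (auto simp: K_def)
    then show "connected (insert (p u) (K u))" using that mem by (simp add: Q(1) connected_arc_image)
    have "p u \<noteq> p x3" using that mem xu pinj by (metis UnCI)
    then show "p x3 \<in> K u" using that mem pu by (simp add: K_def)
  qed
  have KC: "K u \<inter> path_image (C u') = {}" if "u \<in> U" "u' \<in> U" for u u'
  proof (cases "u = u'")
    case True
    then show ?thesis using same_u[of x3 x1 u] same_u[of x3 x2 u] mem x that
      unfolding piC[OF that(2)] K_def by blast
  next
    case False
    then show ?thesis using diff[of x3 x1 u u'] diff[of x3 x2 u u'] mem x that
      unfolding piC[OF that(2)] K_def by blast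
  qed
  show False
    by (rule theta_no_common_access[OF C[OF mem(4)] C[OF mem(5)] C[OF mem(6)]
          CC[OF mem(4,5) u(2)] CC[OF mem(4,6) u(3)] CC[OF mem(5,6) u(4)]
          uC[OF mem(4)] uC[OF mem(5)] uC[OF mem(6)]
          K[OF mem(4)] _ K[OF mem(5)] _ K[OF mem(6)]])
      (use KC mem(4-6) in blast)+
qed

subsection \<open>Five vertices without \<open>K\<^bsub>2,3\<^esub>\<close>\<close>

text \<open>At least k of n statements hold iff any n - k + 1 of them include a true one. In this
  clause form, bounds on degrees and edge numbers can be passed to \<open>sat\<close>.\<close>

lemma at_least_of_4:
  "2 \<le> (of_bool p + of_bool q + of_bool r + of_bool s :: nat) \<longleftrightarrow>
    (p \<or> q \<or> r) \<and> (p \<or> q \<or> s) \<and> (p \<or> r \<or> s) \<and> (q \<or> r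
      \<or> s)"
  "3 \<le> (of_bool p + of_bool q + of_bool r + of_bool s :: nat) \<longleftrightarrow>
    (p \<or> q) \<and> (p \<or> r) \<and> (p \<or> s) \<and> (q \<or> r) \<and> (q \<or> s)
      \<and> (r \<or> s)"
  "4 \<le> (of_bool p + of_bool q + of_bool r + of_bool s :: nat) \<longleftrightarrow>
    p \<and> q \<and> r \<and> s"
  by (cases p; cases q; cases r; cases s; simp)+

lemma at_least_of_6:
  "4 \<le> (of_bool p + of_bool q + of_bool r + of_bool s + of_bool t + of_bool u :: nat)
      \<longleftrightarrow>
    (p \<or> q \<or> r) \<and> (p \<or> q \<or> s) \<and> (p \<or> q \<or> t) \<and> (p \<or> q
      \<or> u) \<and> (p \<or> r \<or> s) \<and> (p \<or> r \<or> t) \<and> (p \<or> r \<or> u) \<and>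
      (p \<or> s \<or> t) \<and> (p \<or> s \<or> u) \<and> (p \<or> t \<or> u) \<and> (q \<or> r
      \<or> s) \<and> (q \<or> r \<or> t) \<and> (q \<or> r \<or> u) \<and> (q \<or> s \<or> t) \<and>
      (q \<or> s \<or> u) \<and> (q \<or> t \<or> u) \<and> (r \<or> s \<or> t) \<and> (r \<or> s
      \<or> u) \<and> (r \<or> t \<or> u) \<and> (s \<or> t \<or> u)"
  "5 \<le> (of_bool p + of_bool q + of_bool r + of_bool s + of_bool t + of_bool u :: nat)
      \<longleftrightarrow>
    (p \<or> q) \<and> (p \<or> r) \<and> (p \<or> s) \<and> (p \<or> t) \<and> (p \<or> u)
      \<and> (q \<or> r) \<and> (q \<or> s) \<and> (q \<or> t) \<and> (q \<or> u) \<and> (r \<or> s)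
      \<and> (r \<or> t) \<and> (r \<or> u) \<and> (s \<or> t) \<and> (s \<or> u) \<and> (t \<or> u)"
  "6 \<le> (of_bool p + of_bool q + of_bool r + of_bool s + of_bool t + of_bool u :: nat)
      \<longleftrightarrow>
    p \<and> q \<and> r \<and> s \<and> t \<and> u"
  by (cases p; cases q; cases r; cases s; cases t; cases u; simp)+

text \<open>\<open>R\<close> will be adjacency among five neighbours of one vertex. As that vertex
  is adjacent to all five, a \<open>K23\<close> among them would extend to a
  \<open>K33\<close>.\<close>

locale five_vertices =
  fixes R :: "'a \<Rightarrow> 'a \<Rightarrow> bool" and a b c d e :: 'a
  assumes sym: "R u v \<longleftrightarrow> R v u"
    and irrefl: "\<not> R u u"
    and distinct: "distinct [a, b, c, d, e]"
    and no_K23: "distinct [u, v, x, y, z] \<Longrightarrow> {u, v, x, y, z} \<subseteq> {a, b, c, d, e} \<Longrightarrow>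
      \<not> (R u x \<and> R u y \<and> R u z \<and> R v x \<and> R v y \<and> R v z)"
begin

abbreviation M :: "'a set" where "M \<equiv> {a, b, c, d, e}"

abbreviation inner_deg :: "'a \<Rightarrow> nat" where "inner_deg x \<equiv> card {z \<in> M. R x z}"

text \<open>Alphabetical order leaves ten atoms, one per pair, so that statements about the five
  vertices become propositional.\<close>

lemma sym_normal:
  "R b a = R a b" "R c a = R a c" "R d a = R a d" "R e a = R a e" "R c b = R b c"
  "R d b = R b d" "R e b = R b e" "R d c = R c d" "R e c = R c e" "R e d = R d e"
  by (rule sym)+

lemma no_K23_clauses:
  "\<not> (R a c \<and> R a d \<and> R a e \<and> R b c \<and> R b d \<and> R b e)"
  "\<not> (R a b \<and> R a d \<and> R a e \<and> R b c \<and> R c d \<and> R c e)"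
  "\<not> (R a b \<and> R a c \<and> R a e \<and> R b d \<and> R c d \<and> R d e)"
  "\<not> (R a b \<and> R a c \<and> R a d \<and> R b e \<and> R c e \<and> R d e)"
  "\<not> (R a b \<and> R b d \<and> R b e \<and> R a c \<and> R c d \<and> R c e)"
  "\<not> (R a b \<and> R b c \<and> R b e \<and> R a d \<and> R c d \<and> R d e)"
  "\<not> (R a b \<and> R b c \<and> R b d \<and> R a e \<and> R c e \<and> R d e)"
  "\<not> (R a c \<and> R b c \<and> R c e \<and> R a d \<and> R b d \<and> R d e)"
  "\<not> (R a c \<and> R b c \<and> R c d \<and> R a e \<and> R b e \<and> R d e)"
  "\<not> (R a d \<and> R b d \<and> R c d \<and> R a e \<and> R b e \<and> R c e)"
  using no_K23[of a b c d e] no_K23[of a c b d e] no_K23[of a d b c e] no_K23[of a e b c d]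
    no_K23[of b c a d e] no_K23[of b d a c e] no_K23[of b e a c d] no_K23[of c d a b e]
    no_K23[of c e a b d] no_K23[of d e a b c] distinct
    distinct_rev[of "[a, b, c, d, e]"]
  by (simp_all add: sym_normal)

lemma inner_deg_eq:
  "inner_deg a = of_bool (R a b) + of_bool (R a c) + of_bool (R a d) + of_bool (R a e)"
  "inner_deg b = of_bool (R a b) + of_bool (R b c) + of_bool (R b d) + of_bool (R b e)"
  "inner_deg c = of_bool (R a c) + of_bool (R b c) + of_bool (R c d) + of_bool (R c e)"
  "inner_deg d = of_bool (R a d) + of_bool (R b d) + of_bool (R c d) + of_bool (R d e)"
  "inner_deg e = of_bool (R a e) + of_bool (R b e) + of_bool (R c e) + of_bool (R d e)"
proof -
  have sum: "inner_deg x = (\<Sum>z\<in>M. of_bool (R x z))" for x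
    by (simp add: sum_of_bool_eq Int_def)
  show
    "inner_deg a = of_bool (R a b) + of_bool (R a c) + of_bool (R a d) + of_bool (R a e)"
    "inner_deg b = of_bool (R a b) + of_bool (R b c) + of_bool (R b d) + of_bool (R b e)"
    "inner_deg c = of_bool (R a c) + of_bool (R b c) + of_bool (R c d) + of_bool (R c e)"
    "inner_deg d = of_bool (R a d) + of_bool (R b d) + of_bool (R c d) + of_bool (R d e)"
    "inner_deg e = of_bool (R a e) + of_bool (R b e) + of_bool (R c e) + of_bool (R d e)"
    unfolding sum using distinct by (simp_all add: irrefl sym_normal)
qed

text \<open>In the complement, \<open>a\<close>, \<open>b\<close>, \<open>c\<close>,
  \<open>d\<close> have degree at most 1 and \<open>e\<close> at most 2. Hence some two vertices
  have no complement edge to the other three, which makes them the small side of a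
  \<open>K23\<close>.\<close>

lemma not_almost_cubic:
  assumes "inner_deg a \<ge> 3" "inner_deg b \<ge> 3" "inner_deg c \<ge> 3" "inner_deg d \<ge> 3" "inner_deg e \<ge> 2"
  shows False
  using assms no_K23_clauses unfolding inner_deg_eq at_least_of_4 by sat

text \<open>Eight edges leave at most two in the complement, and again some two vertices have no
  complement edge to the other three.\<close>

lemma sum_inner_deg_le: "(\<Sum>x\<in>M. inner_deg x) \<le> 14"
proof (rule ccontr)
  \<comment> \<open>\<open>?x\<close> counts the edges at \<open>a\<close> and \<open>?y\<close> the
    six others. As \<open>?x \<le> 4\<close> and \<open>?y \<le> 6\<close>, a total of 8 forces one
    of three pairs of thresholds.\<close>
  let ?x = "of_bool (R a b) + of_bool (R a c) + of_bool (R a d) + of_bool (R a e) :: nat"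
  let ?y = "of_bool (R b c) + of_bool (R b d) + of_bool (R b e) + of_bool (R c d) + of_bool (R c e)
    + of_bool (R d e) :: nat"
  assume "\<not> (\<Sum>x\<in>M. inner_deg x) \<le> 14"
  moreover have "(\<Sum>x\<in>M. inner_deg x) = inner_deg a + inner_deg b + inner_deg c + inner_deg d + inner_deg e"
    using distinct by simp
  ultimately have "8 \<le> ?x + ?y" unfolding inner_deg_eq by linarith
  moreover have le: "of_bool p \<le> (1::nat)" for p by simp
  ultimately have "2 \<le> ?x \<and> 6 \<le> ?y \<or> 3 \<le> ?x \<and> 5 \<le> ?y \<or> 4 \<le> ?x \<and> 4 \<le> ?y"
    using le[of "R a b"] le[of "R a c"] le[of "R a d"] le[of "R a e"] le[of "R b c"]
      le[of "R b d"] le[of "R b e"] le[of "R c d"] le[of "R c e"] le[of "R d e"]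
    by linarith
  then show False
    using no_K23_clauses unfolding at_least_of_4 at_least_of_6 by sat
qed

text \<open>The complement has degrees at most 1, 1, 1, 2, 2, hence at most three edges. No two
  vertices may be cut off from the other three in it, so it has a component on four vertices: a path
  with inner vertices \<open>d\<close> and \<open>e\<close>. The vertex left over is the apex
  \<open>w\<close>.\<close>

lemma path_plus_apex:
  assumes "inner_deg a \<ge> 3" "inner_deg b \<ge> 3" "inner_deg c \<ge> 3" "inner_deg d \<ge> 2" "inner_deg e \<ge> 2"
  obtains w s t z z' where "{w, s, t} = {a, b, c}" "{z, z'} = {d, e}" "distinct [w, s, t, z, z']"
    "R w s" "R w t" "R w z" "R w z'" "R z s" "R s t" "R t z'"
    "\<not> R z t" "\<not> R z z'" "\<not> R s z'"
proof -
  note obt = that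
  define P where "P w s t z z' \<longleftrightarrow> R w s \<and> R w t \<and> R w z \<and> R w z' \<and> R z s \<and> R s t \<and> R t z'
     \<and> \<not> R z t \<and> \<not> R z z' \<and> \<not> R s z'" for w s t z z'
  \<comment> \<open>Two cases per apex suffice, since reversing the path swaps \<open>s\<close> with
    \<open>t\<close> and \<open>z\<close> with \<open>z'\<close>.\<close>
  have "P a b c d e \<or> P a b c e d \<or> P b a c d e \<or> P b a c e d \<or> P c a b d e \<or> P c a b e d"
    using assms no_K23_clauses unfolding inner_deg_eq P_def sym_normal at_least_of_4 by sat
  moreover have "thesis" if "P w s t z z'" "{w, s, t} = {a, b, c}" "{z, z'} = {d, e}" "distinct [w, s, t, z, z']"
    for w s t z z'
    using obt[OF that(2-4)] that(1) unfolding P_def by blast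
  ultimately show ?thesis
    using distinct distinct_rev[of "[a, b, c, d, e]"] by (elim disjE) (simp_all add: insert_commute)
qed

end

subsection \<open>Neighbourhoods and degrees\<close>

definition nbrs :: "'a set set \<Rightarrow> 'a \<Rightarrow> 'a set" where
  "nbrs E v = {u. {v, u} \<in> E}"

lemma nbrs_sym: "u \<in> nbrs E v \<longleftrightarrow> v \<in> nbrs E u"
  by (simp add: nbrs_def insert_commute)

lemma nbrs_mono: "E' \<subseteq> E \<Longrightarrow> nbrs E' v \<subseteq> nbrs E v"
  by (auto simp: nbrs_def)

lemma sum_card_nbrs_swap:
  assumes "finite A" "finite B"
  shows "(\<Sum>v\<in>A. card (nbrs E v \<inter> B)) = (\<Sum>w\<in>B. card (nbrs E w \<inter> A))"
proof -
  have "(\<Sum>v\<in>A. card (nbrs E v \<inter> B)) = (\<Sum>v\<in>A. \<Sum>w\<in>B. of_bool (w \<in> nbrs E v))"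
    using assms by (simp add: sum_of_bool_eq Int_commute)
  also have "\<dots> = (\<Sum>w\<in>B. \<Sum>v\<in>A. of_bool (v \<in> nbrs E w))"
    by (subst sum.swap) (simp add: nbrs_sym[of _ E])
  also have "\<dots> = (\<Sum>w\<in>B. card (nbrs E w \<inter> A))"
    using assms by (simp add: sum_of_bool_eq Int_commute)
  finally show ?thesis .
qed

lemma simple_graphD:
  assumes "simple_graph V E" 
  shows "finite V" "finite E" "nbrs E v \<subseteq> V" "v \<notin> nbrs E v" "v \<notin> V \<Longrightarrow> nbrs E v = {}"
    "e \<in> E \<Longrightarrow> e \<subseteq> V" "e \<in> E \<Longrightarrow> card e = 2" "finite (nbrs E v)"
proof -
  show fV: "finite V" using assms by (simp add: simple_graph_def)
  show sub: "e \<subseteq> V" and c2: "card e = 2" if "e \<in> E" for e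
    using assms that unfolding simple_graph_def by fastforce+
  then show "finite E" by (intro finite_subset[of E "Pow V"]) (use fV in auto)
  show nV: "nbrs E v \<subseteq> V" using sub by (auto simp: nbrs_def)
  show "v \<notin> nbrs E v" using c2[of "{v}"] by (auto simp: nbrs_def)
  show "v \<notin> V \<Longrightarrow> nbrs E v = {}" using sub by (auto simp: nbrs_def)
  show "finite (nbrs E v)" using nV fV by (rule finite_subset)
qed

lemma card_nbrs_eq_card_edges:
  assumes "simple_graph V E"
  shows "card (nbrs E v) = card {e \<in> E. v \<in> e}"
proof -
  have "bij_betw (\<lambda>u. {v, u}) (nbrs E v) {e \<in> E. v \<in> e}"
  proof (rule bij_betw_imageI)
    show "inj_on (\<lambda>u. {v, u}) (nbrs E v)" by (auto simp: inj_on_def doubleton_eq_iff)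
    have "e \<in> (\<lambda>u. {v, u}) ` nbrs E v" if "e \<in> E" "v \<in> e" for e
    proof -
      obtain x y where e: "e = {x, y}"
        using assms \<open>e \<in> E\<close> unfolding simple_graph_def by meson
      with \<open>v \<in> e\<close> consider "e = {v, y}" | "e = {v, x}" by (auto simp: insert_commute)
      then show ?thesis using \<open>e \<in> E\<close> by cases (auto simp: nbrs_def)
    qed
    then show "(\<lambda>u. {v, u}) ` nbrs E v = {e \<in> E. v \<in> e}" by (auto simp: nbrs_def)
  qed
  then show ?thesis by (rule bij_betw_same_card)
qed

lemma handshake:
  assumes "simple_graph V E"
  shows "(\<Sum>v\<in>V. card (nbrs E v)) = 2 * card E"
proof -
  have "(\<Sum>v\<in>V. card (nbrs E v)) = (\<Sum>v\<in>V. \<Sum>e\<in>E. of_bool (v \<in> e))"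
    using simple_graphD(2)[OF assms] by (simp add: card_nbrs_eq_card_edges[OF assms] sum_of_bool_eq Int_def)
  also have "\<dots> = (\<Sum>e\<in>E. \<Sum>v\<in>V. of_bool (v \<in> e))" by (rule sum.swap)
  also have "\<dots> = (\<Sum>e\<in>E. 2)"
  proof (rule sum.cong[OF refl])
    fix e assume "e \<in> E"
    then have "V \<inter> e = e" "card e = 2" using simple_graphD(6,7)[OF assms] by auto
    then show "(\<Sum>v\<in>V. of_bool (v \<in> e)) = (2::nat)"
      using simple_graphD(1)[OF assms] by (simp add: sum_of_bool_eq)
  qed
  finally show ?thesis by simp
qed

lemma card_set_obtain:
  assumes "card A = n" "0 < n"
  obtains xs where "distinct xs" "set xs = A" "length xs = n"
  using assms finite_distinct_list[of A] by (metis card_gt_0_iff distinct_card)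

subsection \<open>Counting edges\<close>

text \<open>
  By Hall's theorem the assumption \<open>star\<close> says that \<open>uv\<close>, with \<open>u\<close> as the centre of two leaves, is not the
  backbone of \<open>S\<^bsub>2,4\<^esub>\<close>.
\<close>

locale star_K33_free =
  fixes V :: "'a set" and E :: "'a set set"
  assumes simple: "simple_graph V E"
    and star: "v \<in> nbrs E u \<Longrightarrow> 3 \<le> card (nbrs E u) \<Longrightarrow> 5 \<le> card (nbrs E v) \<Longrightarrow>
      card (nbrs E u \<union> nbrs E v) \<le> 7"
    and K33: "x \<noteq> y \<Longrightarrow> x \<noteq> z \<Longrightarrow> y \<noteq> z \<Longrightarrow> card (nbrs E x \<inter> nbrs E y \<inter> nbrs E z) \<le> 2"
begin

abbreviation N :: "'a \<Rightarrow> 'a set" where "N \<equiv> nbrs E"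
abbreviation deg :: "'a \<Rightarrow> nat" where "deg v \<equiv> card (N v)"

lemmas fin = simple_graphD(1,2,8)[OF simple]
lemmas N_sub = simple_graphD(3)[OF simple]
lemmas N_irrefl = simple_graphD(4)[OF simple]

text \<open>The induction deletes vertices. Neighbourhoods only shrink in a subgraph, so the degree
  premises of \<open>star\<close> pass up to \<open>E\<close> and the upper bounds pass
  down.\<close>

lemma star_K33_free_subgraph:
  assumes "simple_graph V' E'" "E' \<subseteq> E"
  shows "star_K33_free V' E'"
proof
  have sub: "nbrs E' v \<subseteq> N v" for v using assms(2) by (rule nbrs_mono)
  have le: "card (nbrs E' v) \<le> deg v" for v using sub fin(3) by (rule card_mono[rotated])
  show "simple_graph V' E'" by fact
  show "card (nbrs E' u \<union> nbrs E' v) \<le> 7"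
    if "v \<in> nbrs E' u" "3 \<le> card (nbrs E' u)" "5 \<le> card (nbrs E' v)" for u v
  proof -
    have "card (nbrs E' u \<union> nbrs E' v) \<le> card (N u \<union> N v)"
      using sub fin(3) by (intro card_mono) blast+
    also have "\<dots> \<le> 7"
      using that le[of u] le[of v] sub[of u] by (intro star) auto
    finally show ?thesis .
  qed
  show "card (nbrs E' x \<inter> nbrs E' y \<inter> nbrs E' z) \<le> 2" if "x \<noteq> y" "x \<noteq> z" "y \<noteq> z" for x y z
  proof -
    have "card (nbrs E' x \<inter> nbrs E' y \<inter> nbrs E' z) \<le> card (N x \<inter> N y \<inter> N z)"
      using sub fin(3) by (intro card_mono) blast+
    also have "\<dots> \<le> 2" using that by (rule K33)
    finally show ?thesis .
  qed
qed

lemma simple_graph_delete: "simple_graph (V - W) {e \<in> E. e \<inter> W = {}}"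
  using simple unfolding simple_graph_def by fastforce

lemma card_edges_delete: "card E = card {e \<in> E. e \<inter> W = {}} + card {e \<in> E. e \<inter> W \<noteq> {}}"
  using fin(2) by (subst card_Un_disjoint[symmetric]) (auto intro: arg_cong[where f = card])

lemma no_K33:
  assumes "x \<noteq> y" "x \<noteq> z" "y \<noteq> z" "distinct [u, v, w]"
    and "{u, v, w} \<subseteq> N x" "{u, v, w} \<subseteq> N y" "{u, v, w} \<subseteq> N z"
  shows False
proof -
  have "card {u, v, w} \<le> card (N x \<inter> N y \<inter> N z)"
    using assms(5-7) fin(3) by (intro card_mono) auto
  also have "\<dots> \<le> 2" using assms(1-3) by (rule K33)
  finally show False using assms(4) by simp
qed

lemma five_nbrs:
  assumes "distinct [a, b, c, d, e]" "{a, b, c, d, e} \<subseteq> N y"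
  shows "five_vertices (\<lambda>u v. v \<in> N u) a b c d e"
proof
  show "v \<in> N u \<longleftrightarrow> u \<in> N v" for u v by (rule nbrs_sym)
  show "u \<notin> N u" for u by (rule N_irrefl)
  show "distinct [a, b, c, d, e]" by fact
  fix u v p q r
  assume d: "distinct [u, v, p, q, r]" and sub: "{u, v, p, q, r} \<subseteq> {a, b, c, d, e}"
  have Ny: "{u, v, p, q, r} \<subseteq> N y" using sub assms(2) by (rule subset_trans)
  then have "y \<noteq> u" "y \<noteq> v" using N_irrefl[of y] by auto
  then show "\<not> (p \<in> N u \<and> q \<in> N u \<and> r \<in> N u \<and> p \<in> N v \<and> q \<in> N v \<and> r \<in> N v)"
    using no_K33[of y u v p q r] d Ny by auto
qed

text \<open>Inclusion-exclusion turns \<open>star\<close> into a lower bound for the degree of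
  \<open>x\<close> within the neighbourhood of \<open>y\<close>.\<close>

lemma inner_deg_ge:
  assumes "x \<in> N y" "3 \<le> deg x" "5 \<le> deg y"
  shows "deg x + deg y \<le> card (N x \<inter> N y) + 7"
  using star[of y x] assms nbrs_sym[of x E y] card_Un_Int[OF fin(3) fin(3), of x y] by simp

text \<open>Removing the neighbour \<open>v\<close> of least inner degree lowers the sum by
  \<open>2 * f v\<close>, at most a third of it. From a sum of at least 22, at least 15 would remain
  on five vertices, where 14 is the maximum.\<close>

lemma inner_deg_sum_le_21:
  assumes "deg y = 6"
  shows "(\<Sum>x\<in>N y. card (N x \<inter> N y)) \<le> 21"
proof (rule ccontr)
  define f where "f x = card (N x \<inter> N y)" for x
  assume "\<not> ?thesis"
  then have big: "(\<Sum>x\<in>N y. f x) \<ge> 22" by (simp add: f_def)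
  have "N y \<noteq> {}" using assms by auto
  then obtain v where v: "v \<in> N y" "\<And>x. x \<in> N y \<Longrightarrow> f v \<le> f x"
    using arg_min_if_finite[OF fin(3), of y f] by (metis not_le)
  have "6 * f v \<le> (\<Sum>x\<in>N y. f x)"
    using sum_bounded_below[of "N y" "f v" f] v assms by simp
  define M where "M = N y - {v}"
  have finM: "finite M" using fin(3) by (simp add: M_def)
  have cM: "card M = 5" using v assms fin(3) by (simp add: M_def)
  have fM: "f x = card {z \<in> M. z \<in> N x} + of_bool (x \<in> N v)" for x
  proof -
    have eq: "N x \<inter> N y = {z \<in> M. z \<in> N x} \<union> (if x \<in> N v then {v} else {})"
      using v(1) nbrs_sym[of x E v] by (auto simp: M_def)
    show ?thesis unfolding f_def eq using finM by (auto simp: M_def)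
  qed
  have "(\<Sum>x\<in>N y. f x) = f v + (\<Sum>x\<in>M. f x)"
    unfolding M_def using v fin(3) by (simp add: sum.remove)
  moreover have "(\<Sum>x\<in>M. f x) = (\<Sum>x\<in>M. card {z \<in> M. z \<in> N x}) + (\<Sum>x\<in>M. of_bool (x \<in> N v))"
    by (simp add: fM sum.distrib)
  moreover have "(\<Sum>x\<in>M. of_bool (x \<in> N v)) = f v"
  proof -
    have "M \<inter> N v = N v \<inter> N y" using N_irrefl[of v] by (auto simp: M_def)
    then show ?thesis using finM by (simp add: f_def sum_of_bool_eq)
  qed
  ultimately have "15 \<le> (\<Sum>x\<in>M. card {z \<in> M. z \<in> N x})"
    using big \<open>6 * f v \<le> _\<close> by linarith
  obtain xs where xs: "distinct xs" "set xs = M" "length xs = 5"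
    using card_set_obtain[OF cM] by auto
  then obtain a b c d e where "xs = [a, b, c, d, e]"
    by (auto simp: length_Suc_conv numeral_eq_Suc)
  with xs have M: "M = {a, b, c, d, e}" and dist: "distinct [a, b, c, d, e]" by auto
  interpret five_vertices "\<lambda>u v. v \<in> N u" a b c d e
    by (rule five_nbrs[OF dist, of y]) (use M in \<open>auto simp: M_def\<close>)
  show False using sum_inner_deg_le \<open>15 \<le> _\<close> unfolding M by linarith
qed

text \<open>For \<open>x \<in> N y\<close>, the union of \<open>N x\<close> and \<open>N y\<close>
  contains the seven vertices of \<open>W\<close> and has at most seven elements, so no edge leaves
  \<open>W\<close>. Sixteen edges on seven vertices just meet the ratio 16/7, so the component can
  be deleted.\<close>

lemma deg_6_component:
  assumes min: "\<And>v. v \<in> V \<Longrightarrow> 3 \<le> deg v" and y: "deg y = 6"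
  defines "W \<equiv> insert y (N y)"
  shows "W \<subseteq> V" "card W = 7" "card {e \<in> E. e \<inter> W \<noteq> {}} \<le> 16"
proof -
  have yV: "y \<in> V" using y simple_graphD(5)[OF simple, of y] by (cases "y \<in> V") auto
  show WV: "W \<subseteq> V" using yV N_sub by (auto simp: W_def)
  have finW: "finite W" using fin(3) by (simp add: W_def)
  show cW: "card W = 7" using y fin(3) N_irrefl by (simp add: W_def)
  have closed: "N x \<subseteq> W" if "x \<in> W" for x
  proof (cases "x = y")
    case False
    then have x: "x \<in> N y" using that by (simp add: W_def)
    then have "y \<in> N x" using nbrs_sym by metis
    have "card (N x \<union> N y) \<le> 7"
      using x y min N_sub by (intro star) (auto simp: \<open>y \<in> N x\<close>)
    moreover have "W \<subseteq> N x \<union> N y" using \<open>y \<in> N x\<close> by (auto simp: W_def)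
    ultimately have "N x \<union> N y = W"
      using cW fin(3) by (metis card_seteq finite_UnI)
    then show ?thesis by blast
  qed (auto simp: W_def)
  define F where "F = {e \<in> E. e \<inter> W \<noteq> {}}"
  have sF: "simple_graph W F"
    unfolding simple_graph_def
  proof (intro conjI finW ballI)
    fix e assume "e \<in> F"
    then have e: "e \<in> E" "e \<inter> W \<noteq> {}" by (simp_all add: F_def)
    have "\<exists>u v. u \<in> V \<and> v \<in> V \<and> u \<noteq> v \<and> e = {u, v}"
      using simple e(1) by (simp add: simple_graph_def)
    then obtain u v where uv: "e = {u, v}" "u \<noteq> v" by blast
    have "u \<in> W \<or> v \<in> W" using e(2) uv(1) by auto
    have "v \<in> N u" "u \<in> N v" using e(1) uv(1) by (simp_all add: nbrs_def insert_commute)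
    then have "u \<in> W" "v \<in> W" using \<open>u \<in> W \<or> v \<in> W\<close> closed by blast+
    then show "\<exists>u v. u \<in> W \<and> v \<in> W \<and> u \<noteq> v \<and> e = {u, v}" using uv by blast
  qed
  have nF: "nbrs F v = N v" if "v \<in> W" for v
    using that by (auto simp: nbrs_def F_def)
  have "2 * card F = (\<Sum>v\<in>W. deg v)"
    using handshake[OF sF] nF by simp
  also have "\<dots> = 6 + (\<Sum>x\<in>N y. deg x)"
    using y fin(3) N_irrefl by (simp add: W_def)
  also have "(\<Sum>x\<in>N y. deg x) = (\<Sum>x\<in>N y. card (N x \<inter> N y) + 1)"
  proof (rule sum.cong[OF refl])
    fix x assume "x \<in> N y"
    then have "N x = insert y (N x \<inter> N y)" using closed[of x] nbrs_sym[of x E y] by (auto simp: W_def)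
    then show "deg x = card (N x \<inter> N y) + 1"
      using N_irrefl[of y] fin(3)[of x] by (metis IntD2 Suc_eq_plus1 card_insert_disjoint finite_Int)
  qed
  also have "\<dots> = (\<Sum>x\<in>N y. card (N x \<inter> N y)) + 6" by (subst sum.distrib) (simp add: y)
  \<comment> \<open>With the 6 for \<open>y\<close> itself the degree sum is at most 33, which
    leaves at most 16 edges.\<close>
  also have "\<dots> \<le> 27" using inner_deg_sum_le_21[OF y] by simp
  finally show "card {e \<in> E. e \<inter> W \<noteq> {}} \<le> 16" unfolding F_def by linarith
qed

section \<open>Discharging for degrees 3, 4 and 5\<close>

context
  assumes deg_ge_3: "v \<in> V \<Longrightarrow> 3 \<le> deg v" and deg_le_5: "v \<in> V \<Longrightarrow> deg v \<le> 5"
begin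

definition D :: "nat \<Rightarrow> 'a set" where "D k = {v \<in> V. deg v = k}"

lemma finite_D: "finite (D k)"
  using fin(1) by (simp add: D_def)

lemma deg_cases: "v \<in> N y \<Longrightarrow> v \<in> D 3 \<or> v \<in> D 4 \<or> v \<in> D 5"
  using deg_ge_3[of v] deg_le_5[of v] N_sub[of y] by (auto simp: D_def)

lemma inner_deg_D5:
  assumes "y \<in> D 5" "x \<in> N y"
  shows "deg x \<le> card (N x \<inter> N y) + 2"
  using inner_deg_ge[OF assms(2)] assms deg_ge_3[of x] N_sub[of y] by (auto simp: D_def)

text \<open>With at most one neighbour of degree 4, four inner degrees in \<open>N y\<close> would
  be at least 3 and the fifth at least 2, against \<open>not_almost_cubic\<close>.\<close>

lemma two_low_nbrs:
  assumes y: "y \<in> D 5" and no3: "N y \<inter> D 3 = {}"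
  shows "2 \<le> card (N y \<inter> D 4)"
proof (rule ccontr)
  assume "\<not> ?thesis"
  then have le1: "card (N y \<inter> D 4) \<le> 1" by simp
  have c5: "card (N y) = 5" using y by (simp add: D_def)
  obtain e where e: "e \<in> N y" "N y \<inter> D 4 \<subseteq> {e}"
  proof (cases "N y \<inter> D 4 = {}")
    case True
    moreover have "N y \<noteq> {}" using c5 by auto
    ultimately show ?thesis using that by blast
  next
    case False
    then obtain e where "e \<in> N y \<inter> D 4" by blast
    moreover have "N y \<inter> D 4 \<subseteq> {e}"
      using le1 calculation fin(3) by (metis card_le_Suc0_iff_eq One_nat_def finite_Int singletonI subsetI)
    ultimately show ?thesis using that by blast
  qed
  have "card (N y - {e}) = 4" using c5 e fin(3) by simp
  then obtain xs where xs: "distinct xs" "set xs = N y - {e}" "length xs = 4"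
    using card_set_obtain[of "N y - {e}" 4] by auto
  then obtain a b c d where "xs = [a, b, c, d]"
    by (auto simp: length_Suc_conv numeral_eq_Suc)
  with xs e(1) have Ny: "N y = {a, b, c, d, e}" and dist: "distinct [a, b, c, d, e]" by auto
  interpret five_vertices "\<lambda>u v. v \<in> N u" a b c d e
    by (rule five_nbrs[OF dist, of y]) (simp add: Ny)
  have inner: "deg x \<le> inner_deg x + 2" if "x \<in> M" for x
    using inner_deg_D5[OF y, of x] that unfolding Ny by (simp add: Int_def conj_commute)
  have "deg x = 5" if "x \<in> M" "x \<noteq> e" for x
  proof -
    have "x \<in> N y" using that(1) unfolding Ny .
    moreover have "x \<notin> D 3" "x \<notin> D 4" using \<open>x \<in> N y\<close> that(2) no3 e(2) by blast+
    ultimately show ?thesis using deg_cases[of x y] by (auto simp: D_def)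
  qed
  then have "deg a = 5" "deg b = 5" "deg c = 5" "deg d = 5" using dist by auto
  moreover have "deg e \<ge> 4" using deg_cases[OF e(1)] no3 e(1) by (auto simp: D_def)
  ultimately show False
    using inner[of a] inner[of b] inner[of c] inner[of d] inner[of e] by (intro not_almost_cubic) auto
qed

text \<open>The inner degrees in \<open>N y\<close> are at least 3, 3, 3, 2, 2, so
  \<open>path_plus_apex\<close> applies. The inner vertices \<open>s\<close> and \<open>t\<close> of
  the path are the neighbours wanted: \<open>z\<close> and \<open>z'\<close> have degree 4, and the
  further common neighbour \<open>p\<close> has degree 3.\<close>

lemma rich_nbrs:
  assumes y: "y \<in> D 5" and no3: "N y \<inter> D 3 = {}" and two4: "card (N y \<inter> D 4) = 2"
  shows "2 \<le> card (N y \<inter> {v \<in> D 5. N v \<inter> D 3 \<noteq> {} \<and> N v \<inter> D 4 \<noteq> {}})"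
proof -
  have c5: "card (N y) = 5" using y by (simp add: D_def)
  obtain d e where de: "N y \<inter> D 4 = {d, e}" "d \<noteq> e" using two4 by (auto simp: card_2_iff)
  have "card (N y - {d, e}) = 3"
    using c5 de fin(3)[of y] by (subst card_Diff_subset) auto
  then obtain a b c where abc: "N y - {d, e} = {a, b, c}" "a \<noteq> b" "a \<noteq> c" "b \<noteq> c"
    by (auto simp: card_3_iff)
  have Ny: "N y = {a, b, c, d, e}" and dist: "distinct [a, b, c, d, e]" using abc de by auto
  interpret five_vertices "\<lambda>u v. v \<in> N u" a b c d e
    by (rule five_nbrs[OF dist, of y]) (simp add: Ny)
  have inner: "deg x \<le> inner_deg x + 2" if "x \<in> M" for x
    using inner_deg_D5[OF y, of x] that unfolding Ny by (simp add: Int_def conj_commute)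
  have "deg x = 5" if "x \<in> {a, b, c}" for x
  proof -
    have "x \<in> N y" "x \<notin> {d, e}" using that abc(1) by blast+
    then have "x \<notin> D 3" "x \<notin> D 4" using no3 de(1) by blast+
    then show ?thesis using deg_cases[OF \<open>x \<in> N y\<close>] by (auto simp: D_def)
  qed
  then have deg5: "deg a = 5" "deg b = 5" "deg c = 5" by auto
  have deg4: "deg d = 4" "deg e = 4" using de by (auto simp: D_def)
  obtain w s t z z' where perm: "{w, s, t} = {a, b, c}" "{z, z'} = {d, e}" "distinct [w, s, t, z, z']"
    and adj: "s \<in> N w" "t \<in> N w" "z \<in> N w" "z' \<in> N w" "s \<in> N z" "t \<in> N s" "z' \<in> N t"
    and nonadj: "t \<notin> N z" "z' \<notin> N z" "z' \<notin> N s"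
  proof (rule path_plus_apex)
    show "3 \<le> inner_deg a" "3 \<le> inner_deg b" "3 \<le> inner_deg c" "2 \<le> inner_deg d" "2 \<le> inner_deg e"
      using inner[of a] inner[of b] inner[of c] inner[of d] inner[of e] deg5 deg4 by auto
  qed (rule that)
  have Ny': "N y = {w, s, t, z, z'}" using perm unfolding Ny by auto
  have degs: "deg w = 5" "deg s = 5" "deg t = 5" "deg z = 4" "deg z' = 4"
    using perm(1,2) deg5 deg4 by (auto simp: doubleton_eq_iff dest!: equalityD1)
  have yV: "y \<in> V" using y by (simp add: D_def)
  have sym: "u \<in> N v" if "v \<in> N u" for u v using that nbrs_sym by metis
  have ne: "y \<notin> {w, s, t, z, z'}" using N_irrefl[of y] Ny' by simp
  have "y \<in> N w" "y \<in> N s" "y \<in> N t" "y \<in> N z" "y \<in> N z'" using Ny' by (auto intro: sym)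
  \<comment> \<open>The known neighbours already exhaust the degree of \<open>w\<close>, while
    \<open>s\<close> and \<open>t\<close> have one more neighbour each.\<close>
  have exact: "N u = A" if "A \<subseteq> N u" "card A = deg u" for u A
    using that fin(3) by (metis card_subset_eq)
  have Nw: "N w = {y, s, t, z, z'}"
    using perm(3) ne degs(1) adj \<open>y \<in> N w\<close> by (intro exact) auto
  have Ns_sub: "{y, w, t, z} \<subseteq> N s" using adj \<open>y \<in> N s\<close> by (auto intro: sym)
  have Nt_sub: "{y, w, s, z'} \<subseteq> N t" using adj \<open>y \<in> N t\<close> by (auto intro: sym)
  obtain p where p: "N s = {y, w, t, z, p}" "p \<notin> {y, w, t, z}"
  proof -
    have "card (N s - {y, w, t, z}) = 1"
      using Ns_sub perm(3) ne degs(2) by (subst card_Diff_subset) auto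
    then obtain p where "N s - {y, w, t, z} = {p}" by (auto simp: card_1_singleton_iff)
    then show ?thesis using Ns_sub by (intro that[of p]) auto
  qed
  obtain q where q: "N t = {y, w, s, z', q}" "q \<notin> {y, w, s, z'}"
  proof -
    have "card (N t - {y, w, s, z'}) = 1"
      using Nt_sub perm(3) ne degs(3) by (subst card_Diff_subset) auto
    then obtain q where "N t - {y, w, s, z'} = {q}" by (auto simp: card_1_singleton_iff)
    then show ?thesis using Nt_sub by (intro that[of q]) auto
  qed
  have p': "p \<notin> {y, w, s, t, z, z'}" using p nonadj N_irrefl[of s] by auto
  have q': "q \<notin> {y, w, s, t, z, z'}" using q nonadj N_irrefl[of t] sym[of q t] by auto
  \<comment> \<open>Otherwise the neighbourhoods of the adjacent vertices \<open>s\<close> and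
    \<open>t\<close> cover eight vertices, against \<open>star\<close>.\<close>
  have "p = q"
  proof (rule ccontr)
    assume "p \<noteq> q"
    have "N s \<union> N t = {y, w, s, t, z, z', p, q}" using p(1) q(1) by auto
    also have "card \<dots> = 8" using perm(3) ne p' q' \<open>p \<noteq> q\<close> by auto
    finally show False using star[of t s] adj degs by simp
  qed
  have pV: "p \<in> V" using p(1) N_sub[of s] by auto
  have sp: "s \<in> N p" "t \<in> N p" using p(1) q(1) \<open>p = q\<close> by (auto intro: sym)
  have out: "x \<notin> N p" if "x \<in> {y, w}" for x
    using that sym[of x p] p' Ny' Nw by auto
  \<comment> \<open>Otherwise \<open>y\<close>, \<open>w\<close>, \<open>p\<close> and
    \<open>s\<close>, \<open>t\<close>, \<open>z\<close> are the sides of a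
    \<open>K33\<close>.\<close>
  have no_z: "z \<notin> N p"
  proof
    assume "z \<in> N p"
    show False
      by (rule no_K33[of y w p s t z])
        (use perm(3) ne p' Ny' Nw sp \<open>z \<in> N p\<close> in auto)
  qed
  \<comment> \<open>By \<open>star\<close>, \<open>p\<close> has at most 7 - 5 = 2 neighbours
    outside \<open>N s\<close>; inside it, only \<open>t\<close> is possible.\<close>
  have deg_p: "deg p = 3"
  proof (rule antisym)
    have "deg s + card (N p - N s) = card (N s \<union> N p)"
      using fin(3) by (metis Un_Diff_cancel card_Un_disjoint Diff_disjoint finite_Diff)
    also have "\<dots> \<le> 7" using star[of s p] sp deg_ge_3[OF pV] degs by (simp add: Un_commute)
    finally have "card (N p - N s) \<le> 2" using degs by simp
    moreover have "N p \<inter> N s \<subseteq> {t}" using out no_z N_irrefl[of p] unfolding p(1) by auto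
    then have "card (N p \<inter> N s) \<le> 1" using card_mono[of "{t}"] by simp
    moreover have "deg p = card (N p \<inter> N s) + card (N p - N s)"
      using fin(3) by (metis card_Int_Diff)
    ultimately show "deg p \<le> 3" by linarith
  qed (rule deg_ge_3[OF pV])
  have zV: "z \<in> V" "z' \<in> V" "s \<in> V" "t \<in> V" using Ny' N_sub[of y] by auto
  have "p \<in> N s \<inter> D 3" "p \<in> N t \<inter> D 3" "z \<in> N s \<inter> D 4" "z' \<in> N t \<inter> D 4"
    using p(1) q(1) \<open>p = q\<close> deg_p degs pV zV by (auto simp: D_def)
  then have "{s, t} \<subseteq> N y \<inter> {v \<in> D 5. N v \<inter> D 3 \<noteq> {} \<and> N v \<inter> D 4 \<noteq> {}}"
    using Ny' degs zV by (auto simp: D_def)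
  then have "card {s, t} \<le> card (N y \<inter> {v \<in> D 5. N v \<inter> D 3 \<noteq> {} \<and> N v \<inter> D 4 \<noteq> {}})"
    using fin(3) by (intro card_mono) auto
  then show ?thesis using perm(3) by simp
qed

text \<open>
  With \<open>p\<close> and \<open>q\<close> neighbours of degree 4 and 3, a vertex of degree 5 receives \<open>3 p + 11 q\<close> and needs 9.
  A vertex in \<open>B\<close> lacks 3; a vertex in \<open>G\<close> has a surplus of at least 5. Each vertex in \<open>B\<close> has two
  neighbours in \<open>G\<close>, and each vertex in \<open>G\<close> at most three in \<open>B\<close>.
\<close>

lemma degree_balance: "3 * card (D 5) \<le> 4 * card (D 4) + 11 * card (D 3)"
proof -
  define p where "p v = card (N v \<inter> D 4)" for v
  define q where "q v = card (N v \<inter> D 3)" for v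
  define B where "B = {v \<in> D 5. q v = 0 \<and> p v = 2}"
  define G where "G = {v \<in> D 5. N v \<inter> D 3 \<noteq> {} \<and> N v \<inter> D 4 \<noteq> {}}"
  have q0: "q v = 0 \<longleftrightarrow> N v \<inter> D 3 = {}" and p0: "p v = 0 \<longleftrightarrow> N v \<inter> D 4 = {}" for v
    using fin(3) by (simp_all add: p_def q_def)
  have finBG: "finite B" "finite G" using finite_D by (simp_all add: B_def G_def)
  have count: "(\<Sum>v\<in>D 5. card (N v \<inter> D k)) \<le> k * card (D k)" for k
  proof -
    have "(\<Sum>v\<in>D 5. card (N v \<inter> D k)) = (\<Sum>w\<in>D k. card (N w \<inter> D 5))"
      by (rule sum_card_nbrs_swap[OF finite_D finite_D])
    also have "\<dots> \<le> (\<Sum>w\<in>D k. k)"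
    proof (rule sum_mono)
      fix w assume "w \<in> D k"
      then show "card (N w \<inter> D 5) \<le> k"
        using card_mono[OF fin(3)[of w], of "N w \<inter> D 5"] by (auto simp: D_def)
    qed
    finally show ?thesis by (simp add: mult.commute)
  qed
  \<comment> \<open>If \<open>q v = 0\<close>, then \<open>3 * p v\<close> is at least 9, or 6 for
    \<open>v\<close> in \<open>B\<close>. If \<open>q v\<close> is positive, 11 suffices outside
    \<open>G\<close>, and in \<open>G\<close> there is at least 3 + 11 = 9 + 5.\<close>
  have charge: "9 + 5 * of_bool (v \<in> G) \<le> 3 * p v + 11 * q v + 3 * of_bool (v \<in> B)" if "v \<in> D 5" for v
  proof (cases "q v = 0")
    case True
    moreover have "2 \<le> p v" using two_low_nbrs[OF that] True by (simp add: q0 p_def)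
    ultimately show ?thesis using that by (cases "p v = 2") (auto simp: B_def G_def q0)
  next
    case False
    then show ?thesis using p0[of v] by (cases "p v = 0") (auto simp: G_def B_def)
  qed
  have "2 * card B \<le> (\<Sum>v\<in>B. card (N v \<inter> G))"
    using sum_mono[of B "\<lambda>_. 2" "\<lambda>v. card (N v \<inter> G)"] rich_nbrs
    by (simp add: B_def G_def q0 p_def)
  also have "\<dots> = (\<Sum>w\<in>G. card (N w \<inter> B))"
    by (rule sum_card_nbrs_swap[OF finBG])
  also have "\<dots> \<le> (\<Sum>w\<in>G. 3)"
  proof (rule sum_mono)
    fix w assume w: "w \<in> G"
    then obtain u v where uv: "u \<in> N w \<inter> D 3" "v \<in> N w \<inter> D 4" by (auto simp: G_def)
    then have "u \<noteq> v" by (auto simp: D_def)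
    \<comment> \<open>Vertices in \<open>B\<close> have degree 5, so two of the five neighbours of
      \<open>w\<close> are not in \<open>B\<close>.\<close>
    have "N w \<inter> B \<subseteq> N w - {u, v}" using uv by (auto simp: B_def D_def)
    then have "card (N w \<inter> B) \<le> card (N w - {u, v})" using fin(3) by (intro card_mono) auto
    also have "\<dots> = 3" using w uv \<open>u \<noteq> v\<close> fin(3) by (simp add: card_Diff_subset G_def D_def)
    finally show "card (N w \<inter> B) \<le> 3" .
  qed
  finally have BG: "2 * card B \<le> 3 * card G" by simp
  have "(\<Sum>v\<in>D 5. 9 + 5 * of_bool (v \<in> G)) \<le> (\<Sum>v\<in>D 5. 3 * p v + 11 * q v + 3 * of_bool (v \<in> B))"
    by (rule sum_mono[OF charge])
  moreover have "(\<Sum>v\<in>D 5. of_bool (v \<in> G)) = card G" "(\<Sum>v\<in>D 5. of_bool (v \<in> B)) = card B"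
    using finite_D by (auto simp: sum_of_bool_eq G_def B_def intro!: arg_cong[where f = card])
  ultimately have "9 * card (D 5) + 5 * card G \<le> 3 * (\<Sum>v\<in>D 5. p v) + 11 * (\<Sum>v\<in>D 5. q v) + 3 * card B"
    by (simp add: sum.distrib flip: sum_distrib_left)
  moreover have "(\<Sum>v\<in>D 5. p v) \<le> 4 * card (D 4)" "(\<Sum>v\<in>D 5. q v) \<le> 3 * card (D 3)"
    using count[of 4] count[of 3] by (simp_all add: p_def q_def)
  \<comment> \<open>By \<open>BG\<close>, \<open>3 * card B \<le> 5 * card G\<close>, so these terms
    drop out; the rest is divided by 3.\<close>
  ultimately show ?thesis using BG by linarith
qed

text \<open>With n3, n4, n5 the sizes of \<open>D 3\<close>, \<open>D 4\<close>, \<open>D 5\<close>,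
  the bound reads 7 (3 n3 + 4 n4 + 5 n5) \<le> 32 (n3 + n4 + n5), which is
  \<open>degree_balance\<close> rearranged.\<close>

lemma card_edges_le_min_deg_3: "7 * card E \<le> 16 * card V"
proof -
  have V: "V = D 3 \<union> D 4 \<union> D 5"
    using deg_ge_3 deg_le_5 by (force simp: D_def)
  have disj: "D 3 \<inter> D 4 = {}" "(D 3 \<union> D 4) \<inter> D 5 = {}" by (auto simp: D_def)
  have cV: "card V = card (D 3) + card (D 4) + card (D 5)"
    by (subst arg_cong[OF V, of card]) (use finite_D disj in \<open>simp add: card_Un_disjoint\<close>)
  have const: "(\<Sum>v\<in>D k. deg v) = k * card (D k)" for k
    by (simp add: D_def)
  have "2 * card E = (\<Sum>v\<in>V. deg v)" by (simp add: handshake[OF simple])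
  also have "\<dots> = (\<Sum>v\<in>D 3. deg v) + (\<Sum>v\<in>D 4. deg v) + (\<Sum>v\<in>D 5. deg v)"
    by (subst arg_cong[OF V, of "sum deg"]) (use finite_D disj in \<open>simp add: sum.union_disjoint\<close>)
  finally show ?thesis using degree_balance cV const[of 3] const[of 4] const[of 5] by linarith
qed

end

end

section \<open>Induction on the number of vertices\<close>

lemma card_edges_le:
  assumes "star_K33_free V E"
  shows "7 * card E \<le> 16 * card V"
  using assms
proof (induction "card V" arbitrary: V E rule: less_induct)
  case less
  interpret star_K33_free V E by fact
  \<comment> \<open>A nonempty set meeting at most 16/7 edges per vertex can be deleted. This serves
    for one vertex of degree at most 2 and for the component of a vertex of degree 6.\<close>
  have reduce: ?case if W: "W \<subseteq> V" "W \<noteq> {}" and edges: "7 * card {e \<in> E. e \<inter> W \<noteq> {}} \<le> 16 * card W" for W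
  proof -
    have cV: "card V = card (V - W) + card W"
      using W fin(1) by (metis card_Diff_subset card_mono finite_subset le_add_diff_inverse2)
    have "finite W" using W(1) fin(1) by (rule finite_subset)
    then have "card (V - W) < card V" using W cV by (simp add: card_gt_0_iff)
    then have "7 * card {e \<in> E. e \<inter> W = {}} \<le> 16 * card (V - W)"
      by (rule less.hyps) (rule star_K33_free_subgraph[OF simple_graph_delete], blast)
    then show ?thesis using edges cV card_edges_delete[of W] by linarith
  qed
  show ?case
  proof (cases "\<exists>v\<in>V. deg v \<le> 2")
    case True
    then obtain v where v: "v \<in> V" "deg v \<le> 2" by blast
    then show ?thesis by (intro reduce[of "{v}"]) (simp_all add: card_nbrs_eq_card_edges[OF simple])
  next
    case False
    then have min: "3 \<le> deg v" if "v \<in> V" for v using that by force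
    \<comment> \<open>If \<open>deg v\<close> exceeded 6, then \<open>v\<close> and its neighbours
      would be at least eight vertices in \<open>N u \<union> N v\<close> for any neighbour
      \<open>u\<close>, against \<open>star\<close>.\<close>
    have max: "deg v \<le> 6" if "v \<in> V" for v
    proof (rule ccontr)
      assume "\<not> deg v \<le> 6"
      then have "N v \<noteq> {}" by auto
      then obtain u where u: "u \<in> N v" by blast
      then have "v \<in> N u" "u \<in> V" using nbrs_sym[of u E v] N_sub by auto
      then have "card (N u \<union> N v) \<le> 7" using min[of u] \<open>\<not> deg v \<le> 6\<close> by (intro star) auto
      moreover have "card (insert v (N v)) \<le> card (N u \<union> N v)"
        using fin(3) \<open>v \<in> N u\<close> by (intro card_mono) auto
      ultimately show False using fin(3)[of v] N_irrefl[of v] \<open>\<not> deg v \<le> 6\<close> by simp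
    qed
    show ?thesis
    proof (cases "\<exists>y\<in>V. deg y = 6")
      case True
      then obtain y where "deg y = 6" by blast
      note comp = deg_6_component[OF min this]
      then show ?thesis by (intro reduce[of "insert y (N y)"]) auto
    next
      case False
      then have "deg v \<le> 5" if "v \<in> V" for v using that max[OF that] by (metis Suc_numeral le_SucE semiring_norm(5) semiring_norm(8))
      then show ?thesis using min by (intro card_edges_le_min_deg_3)
    qed
  qed
qed

section \<open>Planar graphs without double stars\<close>

text \<open>Disjoint sets of two leaves at \<open>u\<close> and four at \<open>v\<close> are sought
  in \<open>A\<close> and \<open>B\<close>. Hall's condition holds, because the union of the
  neighbourhoods keeps six elements without \<open>u\<close> and \<open>v\<close>.\<close>

lemma double_star_2_4_subgraph:
  assumes simple: "simple_graph V E" and uv: "v \<in> nbrs E u"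
    and u: "3 \<le> card (nbrs E u)" and v: "5 \<le> card (nbrs E v)"
    and large: "8 \<le> card (nbrs E u \<union> nbrs E v)"
  shows "contains_subgraph (double_star_V 2 4) (double_star_E 2 4) V E"
proof -
  note fin = simple_graphD(8)[OF simple]
  define A where "A = nbrs E u - {v}"
  define B where "B = nbrs E v - {u}"
  have vu: "u \<in> nbrs E v" using uv nbrs_sym by metis
  have finAB: "finite A" "finite B" using fin by (simp_all add: A_def B_def)
  have cA: "2 \<le> card A" and cB: "4 \<le> card B"
    using u v uv vu fin by (simp_all add: A_def B_def)
  have "nbrs E u \<union> nbrs E v = insert u (insert v (A \<union> B))"
    using uv vu by (auto simp: A_def B_def)
  then have "8 \<le> card (insert u (insert v (A \<union> B)))" using large by simp
  also have "\<dots> \<le> card (A \<union> B) + 2"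
    by (simp add: card_insert_if finAB)
  finally have cAB: "6 \<le> card (A \<union> B)" by simp
  \<comment> \<open>The leaves at \<open>u\<close> are taken outside \<open>B\<close> as far as
    possible. If \<open>A - B\<close> has fewer than two elements, \<open>X\<close> contains it;
    then \<open>X\<close> and \<open>B - X\<close> cover \<open>A \<union> B\<close>, and 6 - 2 = 4
    elements are left for \<open>v\<close>.\<close>
  obtain X where X: "X \<subseteq> A" "card X = 2" "4 \<le> card (B - X)"
  proof (cases "2 \<le> card (A - B)")
    case True
    then obtain X where "X \<subseteq> A - B" "card X = 2" by (meson obtain_subset_with_card_n)
    moreover from this have "B - X = B" by blast
    ultimately show ?thesis using that[of X] cB by auto
  next
    case False
    then obtain X where X: "A - B \<subseteq> X" "X \<subseteq> A" "card X = 2"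
      using exists_subset_between[of "A - B" 2 A] cA finAB by auto
    then have "A \<union> B \<subseteq> X \<union> (B - X)" by blast
    then have "card (A \<union> B) \<le> card (X \<union> (B - X))"
      using finAB X(2) by (intro card_mono) (auto intro: finite_subset)
    also have "\<dots> \<le> 2 + card (B - X)" using card_Un_le[of X "B - X"] X(3) by simp
    finally show ?thesis using that[of X] X cAB by simp
  qed
  obtain Y where Y: "Y \<subseteq> B - X" "card Y = 4" using X(3) by (meson obtain_subset_with_card_n)
  obtain xs where xs: "distinct xs" "set xs = X" "length xs = 2"
    using card_set_obtain[OF X(2)] by auto
  obtain ys where ys: "distinct ys" "set ys = Y" "length ys = 4"
    using card_set_obtain[OF Y(2)] by auto
  \<comment> \<open>The list follows the numbering of the double star: positions 0 and 1 are the
    backbone, 2 and 3 the leaves at \<open>u\<close>, 4 to 7 those at \<open>v\<close>.\<close>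
  define f where "f = (!) (u # v # xs @ ys)"
  have uV: "u \<in> V" "v \<in> V" "X \<subseteq> V" "Y \<subseteq> V"
    using simple_graphD(3)[OF simple] uv vu X(1) Y(1) unfolding A_def B_def by blast+
  have "u \<noteq> v" using uv simple_graphD(4)[OF simple] by auto
  then have dist: "distinct (u # v # xs @ ys)"
    using xs ys X(1) Y(1) simple_graphD(4)[OF simple] by (auto simp: A_def B_def)
  have inj: "inj_on f (double_star_V 2 4)"
    unfolding f_def by (rule inj_on_nth[OF dist]) (simp add: double_star_V_def xs ys)
  have img: "f ` double_star_V 2 4 \<subseteq> V"
  proof -
    have sub: "set (u # v # xs @ ys) \<subseteq> V" using uV xs ys by simp
    have "f i \<in> V" if "i < 8" for i
    proof (rule subsetD[OF sub])
      show "f i \<in> set (u # v # xs @ ys)"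
        unfolding f_def using that xs ys by (intro nth_mem) simp
    qed
    then show ?thesis by (auto simp: double_star_V_def)
  qed
  have f01: "f 0 = u" "f 1 = v" by (simp_all add: f_def)
  have fX: "f i \<in> nbrs E u" if "2 \<le> i" "i < 4" for i
  proof -
    define j where "j = i - 2"
    have j: "i = Suc (Suc j)" "j < length xs" using that xs by (simp_all add: j_def)
    then have "f i \<in> X" using xs nth_mem[of j xs] by (simp add: f_def nth_append)
    then show ?thesis using X(1) by (auto simp: A_def)
  qed
  have fY: "f i \<in> nbrs E v" if "4 \<le> i" "i < 8" for i
  proof -
    define j where "j = i - 4"
    have j: "i = Suc (Suc (length xs + j))" "j < length ys" using that xs ys by (simp_all add: j_def)
    then have "f i \<in> Y" using ys nth_mem[of j ys] by (simp add: f_def nth_append)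
    then show ?thesis using Y(1) by (auto simp: B_def)
  qed
  have "f ` e \<in> E" if "e \<in> double_star_E 2 4" for e
  proof -
    have "e = {0, 1} \<or> (\<exists>i. e = {0, i} \<and> 2 \<le> i \<and> i < 4) \<or> (\<exists>i. e = {1, i} \<and> 4 \<le> i \<and> i < 8)"
      using that unfolding double_star_E_def by auto
    then show ?thesis using uv fX fY f01 by (auto simp: nbrs_def)
  qed
  with inj img show ?thesis unfolding contains_subgraph_def by blast
qed

lemma planar_common_nbrs_le_2:
  assumes simple: "simple_graph V E" and planar: "planar V E"
    and ne: "x \<noteq> y" "x \<noteq> z" "y \<noteq> z"
  shows "card (nbrs E x \<inter> nbrs E y \<inter> nbrs E z) \<le> 2"
proof (rule ccontr)
  assume "\<not> ?thesis"
  then have "3 \<le> card (nbrs E x \<inter> nbrs E y \<inter> nbrs E z)" by simp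
  then obtain U where U: "U \<subseteq> nbrs E x \<inter> nbrs E y \<inter> nbrs E z" "card U = 3"
    by (meson obtain_subset_with_card_n)
  have "U \<noteq> {}" using U(2) by auto
  then have "{x, y, z} \<union> U \<subseteq> V"
    using U(1) simple_graphD(3,5)[OF simple] by blast
  moreover have "{x, y, z} \<inter> U = {}"
    using U(1) simple_graphD(4)[OF simple] by blast
  moreover have "card {x, y, z} = 3" using ne by simp
  ultimately show False
    using U by (intro planar_no_K33[OF planar, of "{x, y, z}" U]) (auto simp: nbrs_def)
qed

lemma planar_star_free_card_edges_le:
  assumes "simple_graph V E" "planar V E"
    and free: "\<not> contains_subgraph (double_star_V 2 4) (double_star_E 2 4) V E"
  shows "7 * card E \<le> 16 * card V"
proof (rule card_edges_le, unfold_locales)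
  show "simple_graph V E" by fact
  show "card (nbrs E u \<union> nbrs E v) \<le> 7"
    if "v \<in> nbrs E u" "3 \<le> card (nbrs E u)" "5 \<le> card (nbrs E v)" for u v
    using double_star_2_4_subgraph[OF assms(1) that] free by linarith
qed (rule planar_common_nbrs_le_2[OF assms(1,2)])

theorem theorem1p1:
  fixes n :: nat
  assumes "n \<ge> 12"
  shows "real (planar_turan n (double_star_V 2 4) (double_star_E 2 4)) \<le> 17/7 * real n - 2"
proof -
  define S where "S = {card E | E. simple_graph {0..<n} E \<and> planar {0..<n} E
        \<and> \<not> contains_subgraph (double_star_V 2 4) (double_star_E 2 4) {0..<n} E}"
  have bound: "7 * m \<le> 16 * n" if "m \<in> S" for m
    using that planar_star_free_card_edges_le[of "{0..<n}"] by (auto simp: S_def)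
  have "S \<subseteq> {..16 * n}" using bound by force
  then have "finite S" by (rule finite_subset) simp
  \<comment> \<open>The edgeless graph makes \<open>S\<close> nonempty, so that \<open>Max S\<close>
    is attained.\<close>
  moreover have "0 \<in> S"
  proof -
    have "planar {0..<n} {}"
      unfolding planar_def by (rule exI[of _ of_nat]) (simp add: inj_on_def)
    moreover have "\<not> contains_subgraph (double_star_V 2 4) (double_star_E 2 4) {0..<n} {}"
      by (auto simp: contains_subgraph_def double_star_E_def)
    ultimately show ?thesis by (auto simp: S_def simple_graph_def intro!: exI[of _ "{}"])
  qed
  ultimately have "Max S \<in> S" by (intro Max_in) auto
  then have "7 * Max S \<le> 16 * n" by (rule bound)
  \<comment> \<open>For \<open>n = 12\<close> and \<open>n = 13\<close>, rounding down 192/7 and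
    208/7 gives at most 27 and 29 edges, hence 203 \<le> 204 and 217 \<le> 221.\<close>
  then have "7 * Max S + 14 \<le> 17 * n"
    using assms by presburger
  then have "real (7 * Max S + 14) \<le> real (17 * n)" by (rule of_nat_mono)
  then show ?thesis unfolding planar_turan_def S_def by simp
qed

end
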